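(* Let $s>0$, $\lambda>0$ and $K\ge 1$. Let $\rho$ be a distortion measure on a measurable space $E$ such that $w:=\sup_{x,y\in E}\rho(x,y)<\infty$ and such that the upper box dimension $$\gamma:=\limsup_{\varepsilon\to 0}\frac{\log N(E,\rho,\varepsilon)}{\log(1/\varepsilon)}$$ is finite. Let $X$ be a $\mathbf D([0,1),E)$-valued random element whose number of jumps $N_X$ satisfies $\mathbb P(N_X=k)\le \frac{\lambda^k}{k!}e^{-\lambda}K$ for all integers $k\ge 0$. Then, as $r\to\infty$, $$-\log D^{(q)}(r\,|\,X,\rho_{\mathbf D},s)\ \gtrsim\ \sqrt{\frac{2}{s(1+\gamma)}\,r\log r},$$ i.e. $\liminf_{r\to\infty}\big(-\log D^{(q)}(r\,|\,X,\rho_{\mathbf D},s)\big)\big/\sqrt{\tfrac{2}{s(1+\gamma)}r\log r}\ge 1$.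
   Context: A distortion measure on a measurable space $E$ is a measurable symmetric function $\rho:E\times E\to[0,\infty)$ with $\rho(x,y)=0$ iff $x=y$. The covering number $N(E,\rho,\varepsilon)$ is the smallest $n\in\mathbb N$ such that there exist $x_1,\dots,x_n\in E$ with: for every $x\in E$ there is $i$ with $\rho(x,x_i)\le\varepsilon$. $\mathbf D([0,1),E)$ is the space of functions $f:[0,1)\to E$ that are piecewise constant with finitely many jumps, where a jump at $t$ from value $a$ to value $b$ means $f(t)=b$; it carries the $\sigma$-field generated by the projections $f\mapsto f(t)$. On it one uses the distortion $\rho_{\mathbf D}(f,g)=\int_0^1\rho(f(t),g(t))\,dt$. $N_X$ denotes the (random) number of jumps of $X$. For a random variable $X$ in a space with distortion $\rho$, the quantization error is $$D^{(q)}(r\,|\,X,\rho,s)=\inf\Big\{\big(\mathbb E\min_{a\in\mathcal C}\rho(X,a)^s\big)^{1/s}:\ \mathcal C\text{ a set of points with }\log\#\mathcal C\le r\Big\},$$ with natural logarithms throughout. *)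

theory Defs
  imports "HOL-Probability.Probability"
begin

definition distortion_measure :: "'e measure \<Rightarrow> ('e \<Rightarrow> 'e \<Rightarrow> real) \<Rightarrow> bool" where
  "distortion_measure ME \<rho> \<longleftrightarrow>
     (\<lambda>(x, y). \<rho> x y) \<in> borel_measurable (ME \<Otimes>\<^sub>M ME) \<and>
     (\<forall>x\<in>space ME. \<forall>y\<in>space ME. \<rho> x y = \<rho> y x) \<and>
     (\<forall>x\<in>space ME. \<forall>y\<in>space ME. 0 \<le> \<rho> x y) \<and>
     (\<forall>x\<in>space ME. \<forall>y\<in>space ME. \<rho> x y = 0 \<longleftrightarrow> x = y)"

text \<open>Covering number (infinite if no finite cover exists).\<close>
definition covering_number :: "'e set \<Rightarrow> ('e \<Rightarrow> 'e \<Rightarrow> real) \<Rightarrow> real \<Rightarrow> enat" where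
  "covering_number E \<rho> \<epsilon> =
     (INF C \<in> {C. finite C \<and> C \<subseteq> E \<and> (\<forall>x\<in>E. \<exists>c\<in>C. \<rho> x c \<le> \<epsilon>)}. enat (card C))"

definition ln_enat :: "enat \<Rightarrow> ereal" where
  "ln_enat n = (case n of enat m \<Rightarrow> ereal (ln (real m)) | \<infinity> \<Rightarrow> \<infinity>)"

definition upper_box_dim :: "'e set \<Rightarrow> ('e \<Rightarrow> 'e \<Rightarrow> real) \<Rightarrow> ereal" where
  "upper_box_dim E \<rho> =
     Limsup (at_right 0) (\<lambda>\<epsilon>. ln_enat (covering_number E \<rho> \<epsilon>) / ereal (ln (1 / \<epsilon>)))"

text \<open>The space D([0,1),E): functions on [0,1) (extensional), with values in E,
  piecewise constant with finitely many jumps, right-continuous at jumps.\<close>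
definition Dset :: "'e set \<Rightarrow> (real \<Rightarrow> 'e) set" where
  "Dset E = {f. f \<in> extensional {0..<1} \<and> f ` {0..<1} \<subseteq> E \<and>
     (\<exists>J. finite J \<and> J \<subseteq> {0<..<1} \<and>
        (\<forall>s t. 0 \<le> s \<and> s \<le> t \<and> t < 1 \<and> {s<..t} \<inter> J = {} \<longrightarrow> f s = f t))}"

definition Dspace :: "'e measure \<Rightarrow> (real \<Rightarrow> 'e) measure" where
  "Dspace ME = sigma (Dset (space ME))
     {{f \<in> Dset (space ME). f t \<in> A} | t A. t \<in> {0..<1} \<and> A \<in> sets ME}"

text \<open>Jump times: points t in (0,1) at which f differs from its left limit.\<close>
definition jumps :: "(real \<Rightarrow> 'e) \<Rightarrow> real set" where
  "jumps f = {t \<in> {0<..<1}. \<forall>\<delta>>0. \<exists>u\<in>{t - \<delta><..<t}. f u \<noteq> f t}"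

definition num_jumps :: "(real \<Rightarrow> 'e) \<Rightarrow> nat" where
  "num_jumps f = card (jumps f)"

definition rhoD :: "('e \<Rightarrow> 'e \<Rightarrow> real) \<Rightarrow> (real \<Rightarrow> 'e) \<Rightarrow> (real \<Rightarrow> 'e) \<Rightarrow> real" where
  "rhoD \<rho> f g = set_lebesgue_integral lborel {0..<1} (\<lambda>t. \<rho> (f t) (g t))"

definition quant_err :: "'w measure \<Rightarrow> ('w \<Rightarrow> 'x) \<Rightarrow> 'x set \<Rightarrow> ('x \<Rightarrow> 'x \<Rightarrow> real)
                           \<Rightarrow> real \<Rightarrow> real \<Rightarrow> real" where
  "quant_err P X S d s r =
     Inf {(enn2real (\<integral>\<^sup>+\<omega>. ennreal ((Min ((\<lambda>a. d (X \<omega>) a) ` C)) powr s) \<partial>P)) powr (1 / s) | C.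
            finite C \<and> C \<noteq> {} \<and> C \<subseteq> S \<and> ln (real (card C)) \<le> r}"

definition neg_log :: "real \<Rightarrow> ereal" where
  "neg_log x = (if x = 0 then \<infinity> else ereal (- ln x))"

end

theory Submission
  imports Defs "HOL-Real_Asymp.Real_Asymp"
begin

text \<open>
  A path with \<open>k\<close> jumps is quantized to precision \<open>\<delta>\<close> by sampling it on a grid of mesh about
  \<open>\<delta> / k\<close>, replacing the samples by elements of a \<open>\<delta>\<close>-net of \<open>E\<close> and interpolating them by a step
  function. The sample sequence changes at most \<open>k\<close> times, so this costs about
  \<open>(1 + \<gamma>) k ln (1 / \<delta>)\<close> nats. Since \<open>P (N = k)\<close> is roughly \<open>exp (- k ln k)\<close>, an \<open>s\<close>-th moment of
  order \<open>exp (- L)\<close> only requires the precision \<open>\<delta>\<^sub>k = exp (- (L - k ln k)\<^sup>+ / s)\<close> on \<open>{N = k}\<close>, and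
  none for \<open>k > 2 L / ln L\<close>. The cost \<open>(1 + \<gamma>) k (L - k ln k) / s\<close> is maximal near \<open>k ln k = L / 2\<close>,
  where it is about \<open>(1 + \<gamma>) L\<^sup>2 / (4 s ln L)\<close>; equating this to \<open>r\<close> gives
  \<open>L / s \<approx> sqrt (2 r ln r / (s (1 + \<gamma>)))\<close>.
\<close>

section \<open>Step functions and their jumps\<close>

definition constant_off :: "real set \<Rightarrow> (real \<Rightarrow> 'e) \<Rightarrow> bool" where
  "constant_off J f \<longleftrightarrow>
     (\<forall>s t. 0 \<le> s \<and> s \<le> t \<and> t < 1 \<and> {s<..t} \<inter> J = {} \<longrightarrow> f s = f t)"

lemma constant_offD:
  "constant_off J f \<Longrightarrow> 0 \<le> s \<Longrightarrow> s \<le> t \<Longrightarrow> t < 1 \<Longrightarrow> {s<..t} \<inter> J = {} \<Longrightarrow> f s = f t"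
  by (simp add: constant_off_def)

lemma Dset_iff:
  "f \<in> Dset E \<longleftrightarrow> f \<in> extensional {0..<1} \<and> f ` {0..<1} \<subseteq> E \<and>
     (\<exists>J. finite J \<and> J \<subseteq> {0<..<1} \<and> constant_off J f)"
  by (simp add: Dset_def constant_off_def)

lemma Dset_apply_in: "f \<in> Dset E \<Longrightarrow> 0 \<le> t \<Longrightarrow> t < 1 \<Longrightarrow> f t \<in> E"
  by (auto simp: Dset_iff)

lemma Dset_empty: "Dset {} = {}"
  by (auto simp: Dset_iff)

lemma jumpsE:
  assumes "t \<in> jumps f" "b < t"
  obtains u where "b < u" "u < t" "f u \<noteq> f t"
proof -
  have "\<forall>\<delta>>0. \<exists>u\<in>{t - \<delta><..<t}. f u \<noteq> f t"
    using assms(1) by (simp add: jumps_def)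
  then have "\<exists>u\<in>{t - (t - b)<..<t}. f u \<noteq> f t"
    using assms(2) by (elim allE[of _ "t - b"]) simp
  with that show ?thesis by auto
qed

lemma jumps_subset_if_constant_off:
  assumes "finite J" "constant_off J f"
  shows "jumps f \<subseteq> J"
proof (rule subsetI, rule ccontr)
  fix t assume t: "t \<in> jumps f" "t \<notin> J"
  then have t01: "0 < t" "t < 1" by (auto simp: jumps_def)
  have "open (- J)" using \<open>finite J\<close> by (simp add: finite_imp_closed open_Compl)
  with t(2) obtain e where e: "e > 0" "ball t e \<subseteq> - J" by (auto simp: open_contains_ball)
  obtain u where u: "max 0 (t - e) < u" "u < t" "f u \<noteq> f t"
    using jumpsE[OF t(1), of "max 0 (t - e)"] t01 e(1) by auto
  have "{u<..t} \<subseteq> ball t e" using u by (auto simp: dist_real_def)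
  then have "{u<..t} \<inter> J = {}" using e(2) by blast
  with u t01 show False using constant_offD[OF assms(2), of u t] by simp
qed

lemma constant_off_delete:
  assumes const: "constant_off (insert j J) f" and "j \<notin> jumps f"
  shows "constant_off J f"
  unfolding constant_off_def
proof (intro allI impI)
  fix s t :: real assume st: "0 \<le> s \<and> s \<le> t \<and> t < 1 \<and> {s<..t} \<inter> J = {}"
  show "f s = f t"
  proof (cases "j \<in> {s<..t}")
    case False
    with st show ?thesis by (intro constant_offD[OF const]) auto
  next
    case True
    with st \<open>j \<notin> jumps f\<close> obtain d where d: "d > 0" "\<And>u. u \<in> {j - d<..<j} \<Longrightarrow> f u = f j"
      by (auto simp: jumps_def)
    obtain u where u: "max s (j - d) < u" "u < j"
      using dense[of "max s (j - d)" j] True d(1) by auto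
    have "{s<..u} \<inter> insert j J = {}" using st True u by (auto simp: disjoint_iff)
    then have "f s = f u" using st True u by (intro constant_offD[OF const]) auto
    moreover have "f u = f j" using d(2) u by simp
    moreover have "{j<..t} \<inter> insert j J = {}" using st True by (auto simp: disjoint_iff)
    then have "f j = f t" using st True by (intro constant_offD[OF const]) auto
    ultimately show ?thesis by simp
  qed
qed

lemma constant_off_jumps:
  assumes "finite J" "constant_off J f"
  shows "constant_off (jumps f) f"
proof -
  have "constant_off (jumps f) f"
    if "finite K" "K \<inter> jumps f = {}" "constant_off (K \<union> jumps f) f" for K
    using that
  proof (induction K rule: finite_induct)
    case (insert j K)
    then show ?case using constant_off_delete[of j "K \<union> jumps f" f] by simp
  qed simp
  moreover have "J - jumps f \<union> jumps f = J"
    using jumps_subset_if_constant_off[OF assms] by blast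
  moreover have "(J - jumps f) \<inter> jumps f = {}" by blast
  ultimately show ?thesis using assms by (metis finite_Diff)
qed

lemma constant_off_jumps_Dset: "f \<in> Dset E \<Longrightarrow> constant_off (jumps f) f"
  using constant_off_jumps by (auto simp: Dset_iff)

lemma finite_jumps_Dset:
  "f \<in> Dset E \<Longrightarrow> finite (jumps f)"
  unfolding Dset_iff by (metis jumps_subset_if_constant_off finite_subset)

lemma Dset_neq_across_single_jump:
  assumes f: "f \<in> Dset E" and "0 \<le> a" "a < t" "t \<le> b" "b < 1" "jumps f \<inter> {a<..b} = {t}"
  shows "f a \<noteq> f b"
proof -
  note const = constant_off_jumps_Dset[OF f]
  have "t \<in> jumps f" using assms(6) by blast
  then obtain u where u: "a < u" "u < t" "f u \<noteq> f t" using jumpsE \<open>a < t\<close> by blast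
  have "{a<..u} \<subseteq> {a<..b}" "{t<..b} \<subseteq> {a<..b}" using assms(3,4) u(2) by auto
  then have "{a<..u} \<inter> jumps f \<subseteq> {t}" "{t<..b} \<inter> jumps f \<subseteq> {t}" using assms(6) by blast+
  then have "{a<..u} \<inter> jumps f = {}" "{t<..b} \<inter> jumps f = {}" using u(2) by auto
  then have "f a = f u" "f t = f b"
    using assms(2-5) u(1,2) by (auto intro!: constant_offD[OF const])
  with u(3) show ?thesis by simp
qed

lemma Dset_obtain_no_jumps:
  assumes "E \<noteq> {}"
  obtains f where "f \<in> Dset E" "num_jumps f = 0"
proof -
  obtain x where "x \<in> E" using assms by blast
  define f where "f = restrict (\<lambda>_::real. x) {0..<1}"
  have const: "constant_off {} f" by (simp add: constant_off_def f_def)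
  have "f \<in> Dset E" using const \<open>x \<in> E\<close> unfolding Dset_iff by (auto simp: f_def)
  moreover have "num_jumps f = 0"
    using jumps_subset_if_constant_off[OF _ const] by (simp add: num_jumps_def)
  ultimately show ?thesis by (rule that)
qed

section \<open>Measurability of the number of jumps\<close>

definition changes :: "nat \<Rightarrow> (nat \<Rightarrow> 'a) \<Rightarrow> nat set" where
  "changes n a = {i. i < n \<and> a i \<noteq> a (Suc i)}"

definition grid_values :: "nat \<Rightarrow> (real \<Rightarrow> 'a) \<Rightarrow> nat \<Rightarrow> 'a" where
  "grid_values N f i = f (real i / real N)"

definition grid_cell :: "nat \<Rightarrow> real \<Rightarrow> nat" where
  "grid_cell N t = nat (\<lceil>real N * t\<rceil> - 1)"

lemma grid_cell_eq_iff:
  assumes "N > 0" "t > 0"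
  shows "grid_cell N t = i \<longleftrightarrow> t \<in> {real i / real N<..real (Suc i) / real N}"
proof -
  have "real N * t > 0" using assms by simp
  then have "\<lceil>real N * t\<rceil> \<ge> 1" by linarith
  then have "grid_cell N t = i \<longleftrightarrow> \<lceil>real N * t\<rceil> = int i + 1" by (auto simp: grid_cell_def)
  also have "\<dots> \<longleftrightarrow> real i < real N * t \<and> real N * t \<le> real (Suc i)"
    by (auto simp: ceiling_eq_iff)
  also have "\<dots> \<longleftrightarrow> t \<in> {real i / real N<..real (Suc i) / real N}"
    using assms(1) by (auto simp: field_simps)
  finally show ?thesis .
qed

lemma changes_grid_values_subset:
  assumes f: "f \<in> Dset E"
  shows "changes n (grid_values (Suc n) f) \<subseteq> grid_cell (Suc n) ` jumps f"
proof
  fix i assume i: "i \<in> changes n (grid_values (Suc n) f)"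
  define u where "u = real i / real (Suc n)"
  define v where "v = real (Suc i) / real (Suc n)"
  have "0 \<le> u" "u \<le> v" "v < 1" "f u \<noteq> f v"
    using i by (auto simp: u_def v_def changes_def grid_values_def divide_right_mono)
  then obtain t where t: "t \<in> jumps f" "t \<in> {u<..v}"
    using constant_offD[OF constant_off_jumps_Dset[OF f], of u v] by blast
  then have "grid_cell (Suc n) t = i"
    by (subst grid_cell_eq_iff) (auto simp: u_def v_def jumps_def)
  with t(1) show "i \<in> grid_cell (Suc n) ` jumps f" by blast
qed

lemma card_changes_grid_values_le:
  assumes "f \<in> Dset E"
  shows "card (changes n (grid_values (Suc n) f)) \<le> num_jumps f"
  unfolding num_jumps_def
  by (rule surj_card_le[OF finite_jumps_Dset[OF assms] changes_grid_values_subset[OF assms]])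

lemma eventually_ceiling_mult_less:
  fixes x y :: real
  assumes "x < y"
  shows "eventually (\<lambda>n. \<lceil>real (Suc n) * x\<rceil> < \<lceil>real (Suc n) * y\<rceil>) sequentially"
proof -
  have "eventually (\<lambda>n. real (Suc n) * (y - x) > 1) sequentially"
    using assms by real_asymp
  then show ?thesis by eventually_elim (simp add: algebra_simps, linarith)
qed

lemma eventually_grid_cells_separate:
  assumes "finite S" "S \<subseteq> {0<..<1}"
  shows "eventually (\<lambda>n. inj_on (grid_cell (Suc n)) S \<and> grid_cell (Suc n) ` S \<subseteq> {..<n})
    sequentially"
proof -
  have "eventually (\<lambda>n. \<forall>x\<in>S. \<forall>y\<in>{y \<in> insert 1 S. x < y}.
      \<lceil>real (Suc n) * x\<rceil> < \<lceil>real (Suc n) * y\<rceil>) sequentially"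
    by (intro eventually_ball_finite ballI eventually_ceiling_mult_less) (simp_all add: assms(1))
  then show ?thesis
  proof eventually_elim
    case (elim n)
    have ceiling_less: "\<lceil>real (Suc n) * x\<rceil> < \<lceil>real (Suc n) * y\<rceil>"
      if "x \<in> S" "y \<in> insert 1 S" "x < y" for x y
      using elim that by blast
    have ceiling_pos: "1 \<le> \<lceil>real (Suc n) * x\<rceil>" if "x \<in> S" for x
    proof -
      have "0 < real (Suc n) * x" using that assms(2) by auto
      then show ?thesis by linarith
    qed
    have "grid_cell (Suc n) x < grid_cell (Suc n) y" if "x \<in> S" "y \<in> S" "x < y" for x y
      using ceiling_less[OF that(1) insertI2[OF that(2)] that(3)] ceiling_pos[OF that(1)]
      unfolding grid_cell_def zless_nat_conj by linarith
    then have "inj_on (grid_cell (Suc n)) S" by (intro linorder_inj_onI) (auto dest: less_imp_neq)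
    moreover have "grid_cell (Suc n) x < n" if "x \<in> S" for x
    proof -
      have "\<lceil>real (Suc n) * x\<rceil> < \<lceil>real (Suc n) * 1\<rceil>"
        using that assms(2) by (intro ceiling_less) auto
      then have "\<lceil>real (Suc n) * x\<rceil> < int (Suc n)" by (simp only: mult_1_right ceiling_of_nat)
      with ceiling_pos[OF that] show ?thesis unfolding grid_cell_def by linarith
    qed
    ultimately show ?case by auto
  qed
qed

lemma eventually_card_changes_grid_values:
  assumes f: "f \<in> Dset E"
  shows "eventually (\<lambda>n. card (changes n (grid_values (Suc n) f)) = num_jumps f) sequentially"
proof -
  have jumps01: "jumps f \<subseteq> {0<..<1}" by (auto simp: jumps_def)
  show ?thesis
    using eventually_grid_cells_separate[OF finite_jumps_Dset[OF f] jumps01]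
  proof eventually_elim
    case (elim n)
    have "grid_cell (Suc n) t \<in> changes n (grid_values (Suc n) f)" if t: "t \<in> jumps f" for t
    proof -
      define i where "i = grid_cell (Suc n) t"
      define u where "u = real i / real (Suc n)"
      define v where "v = real (Suc i) / real (Suc n)"
      have "i < n" using elim t by (auto simp: i_def)
      have same_cell: "grid_cell (Suc n) x = i \<longleftrightarrow> x \<in> {u<..v}" if "x \<in> jumps f" for x
        using that jumps01 unfolding u_def v_def by (intro grid_cell_eq_iff) auto
      have "t \<in> {u<..v}" using same_cell[OF t] i_def by blast
      moreover have "x = t" if "x \<in> jumps f" "x \<in> {u<..v}" for x
        using elim t that same_cell[of x] unfolding i_def by (metis inj_onD)
      ultimately have "jumps f \<inter> {u<..v} = {t}" using t by blast
      moreover have "0 \<le> u" "u < t" "t \<le> v" "v < 1"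
        using \<open>i < n\<close> \<open>t \<in> {u<..v}\<close> by (auto simp: u_def v_def)
      ultimately have "f u \<noteq> f v" by (intro Dset_neq_across_single_jump[OF f])
      with \<open>i < n\<close> show ?thesis by (simp add: changes_def grid_values_def u_def v_def i_def)
    qed
    then have "changes n (grid_values (Suc n) f) = grid_cell (Suc n) ` jumps f"
      using changes_grid_values_subset[OF f] by blast
    with elim show ?case by (simp add: card_image num_jumps_def)
  qed
qed

lemma space_Dspace: "space (Dspace ME) = Dset (space ME)"
  unfolding Dspace_def by (rule space_measure_of) auto

lemma Dset_nonempty_if_measurable_Dspace:
  assumes "prob_space P" "X \<in> measurable P (Dspace ME)"
  shows "Dset (space ME) \<noteq> {}"
  using prob_space.not_empty[OF assms(1)] measurable_space[OF assms(2)] by (auto simp: space_Dspace)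

lemma measurable_apply_Dspace:
  assumes "t \<in> {0..<1}"
  shows "(\<lambda>f. f t) \<in> measurable (Dspace ME) ME"
proof (rule measurableI)
  fix A assume "A \<in> sets ME"
  then have "{f \<in> Dset (space ME). f t \<in> A} \<in> sets (Dspace ME)"
    unfolding Dspace_def using assms
    by (subst sets_measure_of) (auto intro!: sigma_sets.Basic)
  also have "{f \<in> Dset (space ME). f t \<in> A} = (\<lambda>f. f t) -` A \<inter> space (Dspace ME)"
    by (auto simp: space_Dspace)
  finally show "(\<lambda>f. f t) -` A \<inter> space (Dspace ME) \<in> sets (Dspace ME)" .
qed (use assms in \<open>auto simp: space_Dspace Dset_apply_in\<close>)

lemma pred_apply_neq_Dspace:
  assumes \<rho>: "distortion_measure ME \<rho>" and "a \<in> {0..<1}" "b \<in> {0..<1}"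
  shows "Measurable.pred (Dspace ME) (\<lambda>f. f a \<noteq> f b)"
proof -
  have "(\<lambda>f. (f a, f b)) \<in> measurable (Dspace ME) (ME \<Otimes>\<^sub>M ME)"
    using assms(2,3) by (intro measurable_Pair measurable_apply_Dspace)
  moreover have "(\<lambda>(x, y). \<rho> x y) \<in> borel_measurable (ME \<Otimes>\<^sub>M ME)"
    using \<rho> by (simp add: distortion_measure_def)
  ultimately have "(\<lambda>f. case (f a, f b) of (x, y) \<Rightarrow> \<rho> x y) \<in> borel_measurable (Dspace ME)"
    by (rule measurable_compose)
  then have [measurable]: "(\<lambda>f. \<rho> (f a) (f b)) \<in> borel_measurable (Dspace ME)" by simp
  have "Measurable.pred (Dspace ME) (\<lambda>f. \<rho> (f a) (f b) \<noteq> 0)" by measurable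
  also have "?this \<longleftrightarrow> ?thesis"
    using assms
    by (intro measurable_cong) (auto simp: distortion_measure_def Dset_apply_in space_Dspace)
  finally show ?thesis .
qed

text \<open>Only the distortion makes the diagonal of \<open>E\<close> measurable; without it, the events
  \<open>num_jumps (X \<omega>) = k\<close> could be non-measurable and have the junk measure 0.\<close>

lemma measurable_num_jumps:
  assumes \<rho>: "distortion_measure ME \<rho>"
  shows "num_jumps \<in> measurable (Dspace ME) (count_space UNIV)"
proof -
  have "(\<lambda>f. real (card (changes n (grid_values (Suc n) f)))) \<in> borel_measurable (Dspace ME)" for n
  proof -
    have "real (card (changes n a)) = (\<Sum>i<n. if a i \<noteq> a (Suc i) then 1 else 0)" for a :: "nat \<Rightarrow> 'a"
      by (simp add: changes_def sum.If_cases Int_def)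
    moreover have "(\<lambda>f. \<Sum>i<n. if grid_values (Suc n) f i \<noteq> grid_values (Suc n) f (Suc i)
        then 1 else 0 :: real) \<in> borel_measurable (Dspace ME)"
      unfolding grid_values_def
      by (intro borel_measurable_sum measurable_If measurable_const
            pred_apply_neq_Dspace[OF \<rho>, unfolded pred_def]) auto
    ultimately show ?thesis by simp
  qed
  moreover have "(\<lambda>n. real (card (changes n (grid_values (Suc n) f)))) \<longlonglongrightarrow> real (num_jumps f)"
    if "f \<in> space (Dspace ME)" for f
    using that eventually_card_changes_grid_values[of f "space ME"]
    by (intro tendsto_eventually) (auto simp: space_Dspace elim: eventually_mono)
  ultimately have [measurable]: "(\<lambda>f. real (num_jumps f)) \<in> borel_measurable (Dspace ME)"
    by (rule borel_measurable_LIMSEQ_real[rotated])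
  have "(\<lambda>f. nat \<lfloor>real (num_jumps f)\<rfloor>) \<in> measurable (Dspace ME) (count_space UNIV)" by measurable
  then show ?thesis by simp
qed

section \<open>Nets of step functions\<close>

definition finite_net :: "'a set \<Rightarrow> 'a set \<Rightarrow> ('a \<Rightarrow> 'a \<Rightarrow> real) \<Rightarrow> real \<Rightarrow> 'a set \<Rightarrow> bool" where
  "finite_net S A d \<epsilon> C \<longleftrightarrow> finite C \<and> C \<subseteq> S \<and> (\<forall>x\<in>A. \<exists>c\<in>C. d x c \<le> \<epsilon>)"

lemma finite_netD:
  assumes "finite_net S A d \<epsilon> C"
  shows "finite C" "C \<subseteq> S" "x \<in> A \<Longrightarrow> \<exists>c\<in>C. d x c \<le> \<epsilon>"
  using assms by (auto simp: finite_net_def)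

lemma finite_net_mono: "finite_net S A d \<epsilon> C \<Longrightarrow> \<epsilon> \<le> \<epsilon>' \<Longrightarrow> finite_net S A d \<epsilon>' C"
  unfolding finite_net_def by (meson order_trans)

lemma covering_number_attained:
  assumes "covering_number E \<rho> \<epsilon> = enat m"
  obtains C where "finite_net E E \<rho> \<epsilon> C" "card C = m"
proof -
  define cards where "cards = (\<lambda>C. enat (card C)) ` Collect (finite_net E E \<rho> \<epsilon>)"
  have Inf_cards: "Inf cards = enat m"
    using assms by (simp add: covering_number_def cards_def finite_net_def[abs_def])
  then have "cards \<noteq> {}" by (auto simp: Inf_enat_def)
  then have "Inf cards \<in> cards" by (auto intro: wellorder_InfI)
  with Inf_cards that show ?thesis by (auto simp: cards_def)
qed

lemma upper_box_dim_nonneg: "0 \<le> upper_box_dim E \<rho>"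
  unfolding upper_box_dim_def
proof (rule le_Limsup)
  show "eventually (\<lambda>\<epsilon>. 0 \<le> ln_enat (covering_number E \<rho> \<epsilon>) / ereal (ln (1 / \<epsilon>))) (at_right 0)"
    using eventually_at_right_real[OF zero_less_one]
  proof eventually_elim
    case (elim \<epsilon>)
    have "ln (real m) \<ge> 0" for m :: nat by (cases m) auto
    then have "0 \<le> ln_enat (covering_number E \<rho> \<epsilon>)" by (auto simp: ln_enat_def split: enat.split)
    moreover have "ln (1 / \<epsilon>) > 0" using elim by simp
    ultimately show ?case by simp
  qed
qed simp

lemma eventually_ex_net_card_le:
  assumes dim: "upper_box_dim E \<rho> < ereal \<gamma>" and "E \<noteq> {}"
  shows "eventually (\<lambda>\<epsilon>. \<exists>C. finite_net E E \<rho> \<epsilon> C \<and> real (card C) \<le> \<epsilon> powr (- \<gamma>)) (at_right 0)"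
  using Limsup_lessD[OF dim[unfolded upper_box_dim_def]] eventually_at_right_real[OF zero_less_one]
proof eventually_elim
  case (elim \<epsilon>)
  have ln_pos: "ln (1 / \<epsilon>) > 0" using elim by simp
  with elim(1) obtain m where m: "covering_number E \<rho> \<epsilon> = enat m"
    by (cases "covering_number E \<rho> \<epsilon>") (auto simp: ln_enat_def)
  then obtain C where C: "finite_net E E \<rho> \<epsilon> C" "card C = m"
    by (rule covering_number_attained)
  with \<open>E \<noteq> {}\<close> have "m > 0" by (auto simp: finite_net_def card_gt_0_iff)
  have "ln (real m) / ln (1 / \<epsilon>) < \<gamma>" using elim(1) ln_pos m by (simp add: ln_enat_def)
  then have "ln (real m) < \<gamma> * ln (1 / \<epsilon>)" using ln_pos by (simp add: field_simps)
  also have "\<dots> = ln (\<epsilon> powr (- \<gamma>))" using elim by (simp add: ln_powr ln_div)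
  finally have "real m < \<epsilon> powr (- \<gamma>)"
    by (subst (asm) ln_less_cancel_iff) (use \<open>m > 0\<close> elim in auto)
  with C show ?case by (intro exI[of _ C]) auto
qed

definition few_changes :: "nat \<Rightarrow> nat \<Rightarrow> 'a set \<Rightarrow> (nat \<Rightarrow> 'a) set" where
  "few_changes n k C = {a \<in> {..n} \<rightarrow>\<^sub>E C. card (changes n a) \<le> k}"

lemma finite_few_changes: "finite C \<Longrightarrow> finite (few_changes n k C)"
  unfolding few_changes_def by (rule finite_subset[of _ "{..n} \<rightarrow>\<^sub>E C"]) (auto intro: finite_PiE)

lemma changes_Suc: "changes (Suc n) a = changes n a \<union> (if a n \<noteq> a (Suc n) then {n} else {})"
  by (auto simp: changes_def less_Suc_eq)

lemma changes_cong: "(\<And>i. i \<le> n \<Longrightarrow> a i = b i) \<Longrightarrow> changes n a = changes n b"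
  by (auto simp: changes_def)

lemma few_changes_Suc_cases:
  assumes a: "a \<in> few_changes (Suc n) k C"
  obtains b where "b \<in> few_changes n k C" "a = b(Suc n := b n)"
  | j b c where "k = Suc j" "b \<in> few_changes n j C" "c \<in> C" "a = b(Suc n := c)"
proof -
  have aC: "a \<in> {..Suc n} \<rightarrow>\<^sub>E C" and card_a: "card (changes (Suc n) a) \<le> k"
    using a by (auto simp: few_changes_def)
  define b where "b = restrict a {..n}"
  have bC: "b \<in> {..n} \<rightarrow>\<^sub>E C" using aC by (auto simp: b_def)
  have a_eq: "a = b(Suc n := a (Suc n))"
    using aC by (auto simp: b_def fun_eq_iff PiE_def extensional_def)
  have changes_b: "changes n b = changes n a" by (rule changes_cong) (simp add: b_def)
  show ?thesis
  proof (cases "a n = a (Suc n)")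
    case True
    then have "b \<in> few_changes n k C"
      using bC card_a changes_b by (simp add: few_changes_def changes_Suc)
    moreover have "a = b(Suc n := b n)" using a_eq True by (simp add: b_def)
    ultimately show ?thesis by (rule that(1))
  next
    case False
    then have "changes (Suc n) a = insert n (changes n b)" by (simp add: changes_Suc changes_b)
    moreover have "finite (changes n b)" "n \<notin> changes n b" by (auto simp: changes_def)
    ultimately have "Suc (card (changes n b)) \<le> k" using card_a by simp
    then obtain j where "k = Suc j" "card (changes n b) \<le> j" by (cases k) auto
    moreover have "a (Suc n) \<in> C" using aC by auto
    ultimately show ?thesis using that(2) bC a_eq by (auto simp: few_changes_def)
  qed
qed

lemma card_few_changes_Suc_0_le:
  assumes "finite C"
  shows "card (few_changes (Suc n) 0 C) \<le> card (few_changes n 0 C)"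
proof (rule surj_card_le)
  show "few_changes (Suc n) 0 C \<subseteq> (\<lambda>b. b(Suc n := b n)) ` few_changes n 0 C"
    by (auto elim: few_changes_Suc_cases)
qed (rule finite_few_changes[OF assms])

lemma card_few_changes_Suc_Suc_le:
  assumes C: "finite C"
  shows "card (few_changes (Suc n) (Suc k) C)
    \<le> card (few_changes n (Suc k) C) + card C * card (few_changes n k C)"
proof -
  define keep where "keep = (\<lambda>b. b(Suc n := b n)) ` few_changes n (Suc k) C"
  define change where "change = (\<lambda>(c, b). b(Suc n := c)) ` (C \<times> few_changes n k C)"
  have keep: "finite keep" "card keep \<le> card (few_changes n (Suc k) C)"
    unfolding keep_def using finite_few_changes[OF C] by (auto intro: card_image_le)
  have change: "finite change" "card change \<le> card C * card (few_changes n k C)"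
    unfolding change_def using finite_few_changes[OF C] C
    by (auto intro: card_image_le[THEN order_trans] simp: card_cartesian_product)
  have "few_changes (Suc n) (Suc k) C \<subseteq> keep \<union> change"
  proof
    fix a assume "a \<in> few_changes (Suc n) (Suc k) C"
    then show "a \<in> keep \<union> change"
      by (cases rule: few_changes_Suc_cases) (auto simp: keep_def change_def image_iff)
  qed
  then have "card (few_changes (Suc n) (Suc k) C) \<le> card (keep \<union> change)"
    using keep change by (intro card_mono) auto
  also have "\<dots> \<le> card (few_changes n (Suc k) C) + card C * card (few_changes n k C)"
    using card_Un_le[of keep change] keep(2) change(2) by linarith
  finally show ?thesis .
qed

lemma card_few_changes_le:
  assumes C: "finite C"
  shows "card (few_changes n k C) \<le> Suc n ^ k * card C ^ Suc k"
proof (induction n arbitrary: k)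
  case 0
  have "card (few_changes 0 k C) \<le> card ({..0::nat} \<rightarrow>\<^sub>E C)"
    unfolding few_changes_def using C by (intro card_mono finite_PiE) auto
  also have "\<dots> = card C" by (simp add: card_PiE)
  also have "\<dots> \<le> card C ^ Suc k" by (cases "card C = 0") (auto intro: self_le_power)
  finally show ?case by simp
next
  case (Suc n)
  show ?case
  proof (cases k)
    case 0
    with Suc.IH[of 0] card_few_changes_Suc_0_le[OF C, of n] show ?thesis by simp
  next
    case (Suc j)
    have "card (few_changes (Suc n) k C)
        \<le> card (few_changes n k C) + card C * card (few_changes n j C)"
      using card_few_changes_Suc_Suc_le[OF C] Suc by simp
    also have "\<dots> \<le> Suc n ^ k * card C ^ Suc k + card C * (Suc n ^ j * card C ^ Suc j)"
      by (intro add_mono mult_left_mono Suc.IH) auto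
    also have "\<dots> = Suc n ^ j * (Suc n + 1) * card C ^ Suc k" using Suc by (simp add: algebra_simps)
    also have "\<dots> \<le> Suc (Suc n) ^ j * (Suc n + 1) * card C ^ Suc k"
      by (intro mult_right_mono power_mono) auto
    finally show ?thesis using Suc by (simp add: mult.commute)
  qed
qed

definition grid_path :: "nat \<Rightarrow> (nat \<Rightarrow> 'e) \<Rightarrow> real \<Rightarrow> 'e" where
  "grid_path N a = restrict (\<lambda>t. a (nat \<lfloor>real N * t\<rfloor>)) {0..<1}"

lemma grid_index:
  fixes t :: real
  assumes "N > 0" "0 \<le> t" "t < 1"
  defines "i \<equiv> nat \<lfloor>real N * t\<rfloor>"
  shows "i < N" "real i / real N \<le> t" "t < real i / real N + 1 / real N"
proof -
  have "real N * t < real N" "0 \<le> real N * t" using assms by auto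
  then have "real i \<le> real N * t" "real N * t < real i + 1" "i < N"
    unfolding i_def by linarith+
  then show "i < N" "real i / real N \<le> t" "t < real i / real N + 1 / real N"
    using assms(1) by (auto simp: field_simps)
qed

lemma grid_path_in_Dset:
  assumes "N > 0" and a: "\<And>i. i < N \<Longrightarrow> a i \<in> E"
  shows "grid_path N a \<in> Dset E"
proof -
  define J where "J = (\<lambda>i. real i / real N) ` {..<N} \<inter> {0<..<1}"
  have "constant_off J (grid_path N a)"
    unfolding constant_off_def
  proof (intro allI impI)
    fix s t :: real assume st: "0 \<le> s \<and> s \<le> t \<and> t < 1 \<and> {s<..t} \<inter> J = {}"
    define i where "i = nat \<lfloor>real N * t\<rfloor>"
    have i: "i < N" "real i / real N \<le> t" using grid_index[OF assms(1)] st by (auto simp: i_def)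
    have "real i / real N \<le> s"
    proof (rule ccontr)
      assume "\<not> real i / real N \<le> s"
      then have "0 < real i / real N" "real i / real N < 1" using i(2) st by linarith+
      then have "real i / real N \<in> J" unfolding J_def using i(1) by (intro IntI imageI) auto
      moreover have "real i / real N \<in> {s<..t}" using i(2) \<open>\<not> real i / real N \<le> s\<close> by simp
      ultimately have "{s<..t} \<inter> J \<noteq> {}" by blast
      with st show False by blast
    qed
    then have "real i \<le> real N * s" using assms(1) by (simp add: field_simps)
    moreover have "real N * s \<le> real N * t" using st by (simp add: mult_left_mono)
    ultimately have "nat \<lfloor>real N * s\<rfloor> = i" unfolding i_def by linarith
    with st show "grid_path N a s = grid_path N a t" by (simp add: grid_path_def i_def)
  qed
  moreover have "grid_path N a ` {0..<1} \<subseteq> E"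
    using a grid_index(1)[OF assms(1)] by (auto simp: grid_path_def)
  ultimately show ?thesis by (auto simp: Dset_iff grid_path_def J_def intro!: exI[of _ J])
qed

lemma rhoD_nonneg:
  assumes "\<And>x y. x \<in> E \<Longrightarrow> y \<in> E \<Longrightarrow> 0 \<le> \<rho> x y" "f \<in> Dset E" "g \<in> Dset E"
  shows "0 \<le> rhoD \<rho> f g"
  unfolding rhoD_def set_lebesgue_integral_def
  using assms by (intro integral_nonneg_AE) (auto simp: indicator_def Dset_apply_in)

text \<open>The Bochner integral of a non-integrable function is 0, so the integral of \<open>h\<close> is a bound
  even if \<open>\<lambda>t. \<rho> (f t) (g t)\<close> is not integrable.\<close>

lemma rhoD_le_integral:
  assumes "integrable lborel h" "\<And>t. 0 \<le> h t"
    and "\<And>t. 0 \<le> t \<Longrightarrow> t < 1 \<Longrightarrow> \<rho> (f t) (g t) \<le> h t"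
  shows "rhoD \<rho> f g \<le> (\<integral>t. h t \<partial>lborel)"
  unfolding rhoD_def set_lebesgue_integral_def
  by (rule integral_mono') (use assms in \<open>auto simp: indicator_def\<close>)

lemma rhoD_le_bound:
  assumes "f \<in> Dset E" "g \<in> Dset E" "0 \<le> w" "\<And>x y. x \<in> E \<Longrightarrow> y \<in> E \<Longrightarrow> \<rho> x y \<le> w"
  shows "rhoD \<rho> f g \<le> w"
proof -
  have "rhoD \<rho> f g \<le> (\<integral>t. w * indicator {0..<1::real} t \<partial>lborel)"
    by (rule rhoD_le_integral) (use assms in \<open>auto simp: Dset_apply_in\<close>)
  then show ?thesis by simp
qed

text \<open>A path and its grid approximation are more than \<open>\<epsilon>\<close> apart only between a jump of the path and
  the next grid point.\<close>

lemma rhoD_grid_path_le: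
  assumes f: "f \<in> Dset E" and "N > 0" "0 \<le> \<epsilon>" "0 \<le> w"
    and w: "\<And>x y. x \<in> E \<Longrightarrow> y \<in> E \<Longrightarrow> \<rho> x y \<le> w"
    and a: "\<And>i. i < N \<Longrightarrow> a i \<in> E \<and> \<rho> (grid_values N f i) (a i) \<le> \<epsilon>"
  shows "rhoD \<rho> f (grid_path N a) \<le> \<epsilon> + w * (real (num_jumps f) / real N)"
proof -
  define lag where "lag t = (\<Sum>\<tau>\<in>jumps f. w * indicator {\<tau>..<\<tau> + 1 / real N} t)" for t :: real
  define h where "h t = \<epsilon> * indicator {0..<1} t + lag t" for t :: real
  have lag_nonneg: "0 \<le> lag t" for t using \<open>0 \<le> w\<close> by (simp add: lag_def sum_nonneg)
  have "rhoD \<rho> f (grid_path N a) \<le> (\<integral>t. h t \<partial>lborel)"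
  proof (rule rhoD_le_integral)
    show "integrable lborel h" by (simp add: h_def[abs_def] lag_def)
    show "0 \<le> h t" for t using lag_nonneg \<open>0 \<le> \<epsilon>\<close> by (simp add: h_def)
    fix t :: real assume t: "0 \<le> t" "t < 1"
    define i where "i = nat \<lfloor>real N * t\<rfloor>"
    define u where "u = real i / real N"
    have i: "i < N" and u: "0 \<le> u" "u \<le> t" "t < u + 1 / real N"
      using grid_index[OF \<open>N > 0\<close> t] by (auto simp: i_def u_def)
    have g: "grid_path N a t = a i" using t by (simp add: grid_path_def i_def)
    show "\<rho> (f t) (grid_path N a t) \<le> h t"
    proof (cases "{u<..t} \<inter> jumps f = {}")
      case True
      then have "f t = grid_values N f i"
        using constant_offD[OF constant_off_jumps_Dset[OF f] u(1,2) t(2)]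
        by (simp add: grid_values_def u_def)
      then have "\<rho> (f t) (grid_path N a t) \<le> \<epsilon>" using a[OF i] g by simp
      also have "\<dots> \<le> h t" using t lag_nonneg by (simp add: h_def)
      finally show ?thesis .
    next
      case False
      then obtain \<tau> where \<tau>: "\<tau> \<in> jumps f" "u < \<tau>" "\<tau> \<le> t" by auto
      have "\<rho> (f t) (grid_path N a t) \<le> w" using w a[OF i] g Dset_apply_in[OF f t] by simp
      also have "\<dots> = w * indicator {\<tau>..<\<tau> + 1 / real N} t" using \<tau> u by simp
      also have "\<dots> \<le> lag t" unfolding lag_def
        using \<tau>(1) \<open>0 \<le> w\<close> finite_jumps_Dset[OF f] by (intro member_le_sum) auto
      also have "\<dots> \<le> h t" using \<open>0 \<le> \<epsilon>\<close> by (simp add: h_def)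
      finally show ?thesis .
    qed
  qed
  also have "(\<integral>t. h t \<partial>lborel) = \<epsilon> + w * (real (num_jumps f) / real N)"
    by (simp add: h_def lag_def num_jumps_def)
  finally show ?thesis .
qed

abbreviation path_net :: "'e set \<Rightarrow> ('e \<Rightarrow> 'e \<Rightarrow> real) \<Rightarrow> nat \<Rightarrow> real \<Rightarrow> (real \<Rightarrow> 'e) set \<Rightarrow> bool" where
  "path_net E \<rho> k \<equiv> finite_net (Dset E) {f \<in> Dset E. num_jumps f \<le> k} (rhoD \<rho>)"

lemma path_net_grid_paths:
  assumes C: "finite_net E E \<rho> \<epsilon> C" and "0 \<le> \<epsilon>" "0 \<le> w"
    and w: "\<And>x y. x \<in> E \<Longrightarrow> y \<in> E \<Longrightarrow> \<rho> x y \<le> w"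
  shows "path_net E \<rho> k (\<epsilon> + w * (real k / real (Suc n)))
    (grid_path (Suc n) ` few_changes n k C)"
  unfolding finite_net_def
proof (intro conjI ballI)
  show "finite (grid_path (Suc n) ` few_changes n k C)"
    using finite_few_changes[OF finite_netD(1)[OF C]] by simp
  show "grid_path (Suc n) ` few_changes n k C \<subseteq> Dset E"
    using finite_netD(2)[OF C] by (auto simp: few_changes_def intro!: grid_path_in_Dset)
  fix f assume "f \<in> {f \<in> Dset E. num_jumps f \<le> k}"
  then have f: "f \<in> Dset E" "num_jumps f \<le> k" by auto
  obtain net where net: "\<And>x. x \<in> E \<Longrightarrow> net x \<in> C \<and> \<rho> x (net x) \<le> \<epsilon>"
    using finite_netD(3)[OF C] by metis
  define a where "a = restrict (\<lambda>i. net (grid_values (Suc n) f i)) {..n}"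
  have values_in: "grid_values (Suc n) f i \<in> E" if "i < Suc n" for i
    using that by (auto simp: grid_values_def intro!: Dset_apply_in[OF f(1)])
  have "changes n a \<subseteq> changes n (grid_values (Suc n) f)" by (auto simp: changes_def a_def)
  then have "card (changes n a) \<le> card (changes n (grid_values (Suc n) f))"
    by (rule card_mono[rotated]) (simp add: changes_def)
  with card_changes_grid_values_le[OF f(1), of n] f(2) have "card (changes n a) \<le> k" by linarith
  moreover have "a \<in> {..n} \<rightarrow>\<^sub>E C" using net values_in by (auto simp: a_def)
  ultimately have "a \<in> few_changes n k C" by (simp add: few_changes_def)
  moreover have "rhoD \<rho> f (grid_path (Suc n) a) \<le> \<epsilon> + w * (real (num_jumps f) / real (Suc n))"
    using net values_in finite_netD(2)[OF C] assms(2,3) w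
    by (intro rhoD_grid_path_le[OF f(1)]) (auto simp: a_def)
  moreover have "w * (real (num_jumps f) / real (Suc n)) \<le> w * (real k / real (Suc n))"
    using f(2) \<open>0 \<le> w\<close> by (intro mult_left_mono divide_right_mono) auto
  ultimately show "\<exists>g\<in>grid_path (Suc n) ` few_changes n k C.
      rhoD \<rho> f g \<le> \<epsilon> + w * (real k / real (Suc n))"
    by (intro bexI[of _ "grid_path (Suc n) a"]) auto
qed

lemma ex_path_net:
  assumes C: "finite_net E E \<rho> \<delta> C" and "0 < \<delta>" "\<delta> \<le> 1" "0 \<le> w"
    and w: "\<And>x y. x \<in> E \<Longrightarrow> y \<in> E \<Longrightarrow> \<rho> x y \<le> w"
  shows "\<exists>G. path_net E \<rho> k ((1 + w) * \<delta>) G \<and>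
    real (card G) \<le> (2 * real (k + 1) / \<delta>) ^ k * real (card C) ^ (k + 1)"
proof (intro exI conjI)
  define n where "n = nat \<lfloor>real (k + 1) / \<delta>\<rfloor>"
  define G where "G = grid_path (Suc n) ` few_changes n k C"
  have "1 \<le> real (k + 1) / \<delta>" using assms(2,3) by (simp add: field_simps)
  then have n: "real (k + 1) / \<delta> < real (Suc n)" "real (Suc n) \<le> 2 * (real (k + 1) / \<delta>)"
    unfolding n_def by linarith+
  have "real k / real (Suc n) \<le> \<delta>"
  proof -
    have "real k \<le> real (k + 1)" by simp
    also have "\<dots> \<le> \<delta> * real (Suc n)" using n(1) \<open>0 < \<delta>\<close> by (simp add: field_simps)
    finally show ?thesis by (simp add: field_simps)
  qed
  then have "w * (real k / real (Suc n)) \<le> w * \<delta>" using \<open>0 \<le> w\<close> by (rule mult_left_mono)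
  then have "\<delta> + w * (real k / real (Suc n)) \<le> (1 + w) * \<delta>" by (simp add: distrib_right)
  then show "path_net E \<rho> k ((1 + w) * \<delta>) G"
    unfolding G_def using assms by (intro finite_net_mono[OF path_net_grid_paths[OF C _ _ w]]) auto
  have "card G \<le> Suc n ^ k * card C ^ (k + 1)"
    using card_few_changes_le[of C n k] finite_few_changes[of C n k] finite_netD(1)[OF C]
    unfolding G_def by (auto intro: card_image_le[THEN order_trans])
  then have "real (card G) \<le> real (Suc n) ^ k * real (card C) ^ (k + 1)"
    by (metis of_nat_le_iff of_nat_mult of_nat_power)
  also have "\<dots> \<le> (2 * real (k + 1) / \<delta>) ^ k * real (card C) ^ (k + 1)"
    using n(2) by (intro mult_right_mono power_mono) auto
  finally show "real (card G) \<le> (2 * real (k + 1) / \<delta>) ^ k * real (card C) ^ (k + 1)" .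
qed

text \<open>The nats that describe a path with \<open>k\<close> jumps to precision \<open>exp (- y)\<close>, for \<open>\<alpha> = 1 + \<gamma>\<close>.\<close>

definition code_length :: "real \<Rightarrow> nat \<Rightarrow> real \<Rightarrow> real" where
  "code_length \<alpha> k y = real (k + 1) * (\<alpha> * y + ln (2 * real (k + 1)))"

lemma eventually_ex_path_net:
  assumes "upper_box_dim E \<rho> < ereal \<gamma>" "E \<noteq> {}" "0 \<le> w"
    and "\<And>x y. x \<in> E \<Longrightarrow> y \<in> E \<Longrightarrow> \<rho> x y \<le> w"
  shows "eventually (\<lambda>\<delta>. \<forall>k. \<exists>G.
    path_net E \<rho> k ((1 + w) * \<delta>) G \<and>
    real (card G) \<le> exp (code_length (1 + \<gamma>) k (ln (1 / \<delta>)))) (at_right 0)"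
  using eventually_ex_net_card_le[OF assms(1,2)] eventually_at_right_real[OF zero_less_one]
proof eventually_elim
  case (elim \<delta>)
  then have \<delta>: "0 < \<delta>" "\<delta> \<le> 1" by auto
  obtain C where C: "finite_net E E \<rho> \<delta> C" "real (card C) \<le> \<delta> powr (- \<gamma>)" using elim(1) by blast
  have "(2 * real (k + 1) / \<delta>) ^ k * real (card C) ^ (k + 1)
      \<le> exp (code_length (1 + \<gamma>) k (ln (1 / \<delta>)))" for k
  proof -
    have "(2 * real (k + 1) / \<delta>) ^ k \<le> (2 * real (k + 1) / \<delta>) ^ (k + 1)"
      using \<delta> by (intro power_increasing) (auto simp: field_simps)
    moreover have "real (card C) ^ (k + 1) \<le> (\<delta> powr (- \<gamma>)) ^ (k + 1)"
      using C(2) by (intro power_mono) auto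
    ultimately have "(2 * real (k + 1) / \<delta>) ^ k * real (card C) ^ (k + 1)
        \<le> (2 * real (k + 1) / \<delta> * \<delta> powr (- \<gamma>)) ^ (k + 1)"
      unfolding power_mult_distrib using \<delta> by (intro mult_mono) auto
    also have "\<delta> powr (- \<gamma>) = exp (\<gamma> * ln (1 / \<delta>))" using \<delta> by (simp add: powr_def ln_div)
    also have "2 * real (k + 1) / \<delta> * exp (\<gamma> * ln (1 / \<delta>))
        = exp (ln (2 * real (k + 1))) * exp (ln (1 / \<delta>)) * exp (\<gamma> * ln (1 / \<delta>))"
      using \<delta> by simp
    also have "\<dots> = exp ((1 + \<gamma>) * ln (1 / \<delta>) + ln (2 * real (k + 1)))"
      unfolding exp_add[symmetric] by (simp add: algebra_simps)
    finally show ?thesis by (simp only: code_length_def exp_of_nat_mult)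
  qed
  with ex_path_net[OF C(1) \<delta> assms(3,4)] show ?case by (meson order_trans)
qed

lemma obtain_path_nets:
  assumes "upper_box_dim E \<rho> < ereal \<gamma>" "E \<noteq> {}" "0 \<le> w"
    and "\<And>x y. x \<in> E \<Longrightarrow> y \<in> E \<Longrightarrow> \<rho> x y \<le> w"
  obtains h where "0 \<le> h"
    "\<And>k y. 0 \<le> y \<Longrightarrow> \<exists>G. path_net E \<rho> k ((1 + w) * exp (- y)) G \<and>
      real (card G) \<le> exp (code_length (1 + \<gamma>) k (h + y))"
proof -
  obtain \<epsilon> where "\<epsilon> > 0" and nets: "\<And>\<delta> k. 0 < \<delta> \<Longrightarrow> \<delta> < \<epsilon> \<Longrightarrow> \<exists>G.
      path_net E \<rho> k ((1 + w) * \<delta>) G \<and>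
      real (card G) \<le> exp (code_length (1 + \<gamma>) k (ln (1 / \<delta>)))"
    using eventually_ex_path_net[OF assms] unfolding eventually_at_right_field by blast
  define \<delta>0 where "\<delta>0 = min 1 (\<epsilon> / 2)"
  have \<delta>0: "0 < \<delta>0" "\<delta>0 \<le> 1" "\<delta>0 < \<epsilon>" using \<open>\<epsilon> > 0\<close> by (auto simp: \<delta>0_def)
  show ?thesis
  proof (rule that)
    show "0 \<le> ln (1 / \<delta>0)" using \<delta>0 by simp
    fix k and y :: real assume "0 \<le> y"
    define \<delta> where "\<delta> = \<delta>0 * exp (- y)"
    have "\<delta> \<le> \<delta>0" using \<open>0 \<le> y\<close> \<delta>0 by (simp add: \<delta>_def mult_le_cancel_left1)
    then have "\<delta> < \<epsilon>" using \<delta>0(3) by linarith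
    moreover have "0 < \<delta>" using \<delta>0(1) by (simp add: \<delta>_def)
    ultimately obtain G where G: "path_net E \<rho> k ((1 + w) * \<delta>) G"
      "real (card G) \<le> exp (code_length (1 + \<gamma>) k (ln (1 / \<delta>)))"
      using nets by blast
    have "(1 + w) * \<delta> \<le> (1 + w) * exp (- y)"
      using \<delta>0 \<open>0 \<le> w\<close> by (intro mult_left_mono) (auto simp: \<delta>_def)
    moreover have "ln (1 / \<delta>) = ln (1 / \<delta>0) + y" using \<delta>0 by (simp add: \<delta>_def ln_div ln_mult)
    ultimately show "\<exists>G. path_net E \<rho> k ((1 + w) * exp (- y)) G \<and>
        real (card G) \<le> exp (code_length (1 + \<gamma>) k (ln (1 / \<delta>0) + y))"
      using G by (auto intro: finite_net_mono)
  qed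
qed

section \<open>Quantization of layered random elements\<close>

lemma quant_err_nonneg:
  assumes "S \<noteq> {}" "0 \<le> r"
  shows "0 \<le> quant_err P X S d s r"
proof -
  obtain a where "a \<in> S" using assms by auto
  then have "\<exists>C. finite C \<and> C \<noteq> {} \<and> C \<subseteq> S \<and> ln (real (card C)) \<le> r"
    using assms(2) by (intro exI[of _ "{a}"]) auto
  then show ?thesis unfolding quant_err_def by (intro cInf_greatest) auto
qed

lemma quant_err_le:
  assumes "finite C" "C \<noteq> {}" "C \<subseteq> S" "real (card C) \<le> exp r" "0 < s" "0 \<le> q"
    and moment: "(\<integral>\<^sup>+\<omega>. ennreal (Min (d (X \<omega>) ` C) powr s) \<partial>P) \<le> ennreal q"
  shows "quant_err P X S d s r \<le> q powr (1 / s)"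
proof -
  have "ln (real (card C)) \<le> r"
    using assms(1,2,4) by (metis card_gt_0_iff ln_exp ln_mono of_nat_0_less_iff)
  then have "quant_err P X S d s r
      \<le> enn2real (\<integral>\<^sup>+\<omega>. ennreal (Min (d (X \<omega>) ` C) powr s) \<partial>P) powr (1 / s)"
    unfolding quant_err_def using assms by (intro cInf_lower bdd_belowI[of _ 0]) auto
  also have "\<dots> \<le> q powr (1 / s)"
    using enn2real_mono[OF moment] \<open>0 < s\<close> \<open>0 \<le> q\<close> by (intro powr_mono2) auto
  finally show ?thesis .
qed

lemma nn_integral_comp_nat:
  fixes g :: "nat \<Rightarrow> ennreal"
  assumes [measurable]: "N \<in> measurable P (count_space UNIV)"
  shows "(\<integral>\<^sup>+\<omega>. g (N \<omega>) \<partial>P) = (\<Sum>k. g k * emeasure P {\<omega> \<in> space P. N \<omega> = k})"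
proof -
  have "(\<integral>\<^sup>+\<omega>. g (N \<omega>) \<partial>P) = (\<integral>\<^sup>+\<omega>. (\<Sum>k. g k * indicator {\<omega> \<in> space P. N \<omega> = k} \<omega>) \<partial>P)"
  proof (rule nn_integral_cong)
    fix \<omega> assume "\<omega> \<in> space P"
    then show "g (N \<omega>) = (\<Sum>k. g k * indicator {\<omega> \<in> space P. N \<omega> = k} \<omega>)"
      by (subst suminf_cmult_indicator[where i = "N \<omega>"]) (auto simp: disjoint_family_on_def)
  qed
  also have "\<dots> = (\<Sum>k. g k * emeasure P {\<omega> \<in> space P. N \<omega> = k})"
    by (subst nn_integral_suminf) (auto simp: nn_integral_cmult_indicator)
  finally show ?thesis .
qed

lemma nn_integral_comp_nat_le_geometric:
  assumes "prob_space P" and N: "N \<in> measurable P (count_space UNIV)" and "0 \<le> q"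
    and weight: "\<And>k. measure P {\<omega> \<in> space P. N \<omega> = k} * F k \<le> (1/2) ^ k * q"
  shows "(\<integral>\<^sup>+\<omega>. ennreal (F (N \<omega>)) \<partial>P) \<le> ennreal (2 * q)"
proof -
  interpret prob_space P by fact
  have layer_eq: "ennreal (F k) * emeasure P {\<omega> \<in> space P. N \<omega> = k}
      = ennreal (measure P {\<omega> \<in> space P. N \<omega> = k} * F k)" for k
    by (simp add: emeasure_eq_measure ennreal_mult'' mult.commute)
  have "(\<integral>\<^sup>+\<omega>. ennreal (F (N \<omega>)) \<partial>P)
      = (\<Sum>k. ennreal (measure P {\<omega> \<in> space P. N \<omega> = k} * F k))"
    by (subst nn_integral_comp_nat[OF N]) (simp only: layer_eq)
  also have "\<dots> \<le> (\<Sum>k. ennreal ((1/2) ^ k * q))"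
    using weight by (intro suminf_le ennreal_leI) auto
  also have "\<dots> = ennreal (2 * q)"
  proof (rule suminf_ennreal_eq)
    show "(\<lambda>k. (1/2) ^ k * q) sums (2 * q)"
      using sums_mult2[OF geometric_sums[of "1/2::real"], of q] by simp
  qed (use \<open>0 \<le> q\<close> in simp)
  finally show ?thesis .
qed

lemma weight_mult_precision_powr_le:
  fixes B L q s x :: real
  assumes "p \<le> q * exp (- x)" "0 < s" "0 \<le> B" "0 \<le> q"
  shows "p * (B * exp (- (max 0 (L - x) / s))) powr s \<le> q * B powr s * exp (- L)"
proof -
  have "(B * exp (- (max 0 (L - x) / s))) powr s = B powr s * exp (- max 0 (L - x))"
    using assms(2,3) by (simp add: powr_mult) (simp add: powr_def)
  then have "p * (B * exp (- (max 0 (L - x) / s))) powr s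
      \<le> q * exp (- x) * (B powr s * exp (- max 0 (L - x)))"
    using mult_right_mono[OF assms(1)] by simp
  also have "\<dots> = q * B powr s * exp (- x - max 0 (L - x))"
    by (simp add: exp_diff exp_minus field_simps)
  also have "\<dots> \<le> q * B powr s * exp (- L)" using \<open>0 \<le> q\<close> by (intro mult_left_mono) auto
  finally show ?thesis .
qed

text \<open>A layer \<open>k\<close> of probability about \<open>exp (- \<phi> k)\<close> only needs the precision that makes its
  contribution to the \<open>s\<close>-th moment about \<open>exp (- L)\<close>, and none at all once \<open>\<phi> k \<ge> L\<close>.\<close>

lemma quant_err_le_of_layer_nets:
  fixes \<phi> :: "nat \<Rightarrow> real" and layer :: "'x \<Rightarrow> nat"
  assumes P: "prob_space P" and X: "\<And>\<omega>. \<omega> \<in> space P \<Longrightarrow> X \<omega> \<in> S"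
    and layer: "(\<lambda>\<omega>. layer (X \<omega>)) \<in> measurable P (count_space UNIV)"
    and d: "\<And>x y. x \<in> S \<Longrightarrow> y \<in> S \<Longrightarrow> 0 \<le> d x y \<and> d x y \<le> B"
    and "0 < s" "0 \<le> B" "0 \<le> K"
    and weight: "\<And>k. measure P {\<omega> \<in> space P. layer (X \<omega>) = k} \<le> (1/2) ^ k * K * exp (- \<phi> k)"
    and nets: "\<And>k. k \<le> n \<Longrightarrow>
      finite_net S {x \<in> S. layer x \<le> k} d (B * exp (- (max 0 (L - \<phi> k) / s))) (G k)"
    and tail: "\<And>k. n < k \<Longrightarrow> L \<le> \<phi> k"
    and nonempty: "(\<Union>k\<le>n. G k) \<noteq> {}" and card: "real (card (\<Union>k\<le>n. G k)) \<le> exp r"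
  shows "quant_err P X S d s r \<le> (2 * K) powr (1 / s) * B * exp (- (L / s))"
proof -
  define C where "C = (\<Union>k\<le>n. G k)"
  have C: "finite C" "C \<noteq> {}" "C \<subseteq> S"
    using nets nonempty by (auto simp: C_def finite_net_def)
  define F where "F k = B * exp (- (max 0 (L - \<phi> k) / s))" for k
  have close: "\<exists>c\<in>C. d (X \<omega>) c \<le> F (layer (X \<omega>))" if \<omega>: "\<omega> \<in> space P" for \<omega>
  proof (cases "layer (X \<omega>) \<le> n")
    case True
    then obtain c where "c \<in> G (layer (X \<omega>))" "d (X \<omega>) c \<le> F (layer (X \<omega>))"
      using finite_netD(3)[OF nets, of "layer (X \<omega>)" "X \<omega>"] X[OF \<omega>] by (auto simp: F_def)
    with True show ?thesis by (auto simp: C_def)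
  next
    case False
    obtain c where "c \<in> C" using C(2) by blast
    with False tail[of "layer (X \<omega>)"] d[OF X[OF \<omega>], of c] C(3)
    show ?thesis by (intro bexI[of _ c]) (auto simp: F_def)
  qed
  have "(\<integral>\<^sup>+\<omega>. ennreal (Min (d (X \<omega>) ` C) powr s) \<partial>P) \<le> (\<integral>\<^sup>+\<omega>. ennreal (F (layer (X \<omega>)) powr s) \<partial>P)"
  proof (intro nn_integral_mono ennreal_leI powr_mono2)
    fix \<omega> assume \<omega>: "\<omega> \<in> space P"
    show "0 \<le> Min (d (X \<omega>) ` C)" using C d X[OF \<omega>] by (subst Min_ge_iff) auto
    show "Min (d (X \<omega>) ` C) \<le> F (layer (X \<omega>))" using close[OF \<omega>] C(1) by (subst Min_le_iff) auto
  qed (use \<open>0 < s\<close> in simp)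
  also have "\<dots> \<le> ennreal (2 * (K * B powr s * exp (- L)))"
  proof (rule nn_integral_comp_nat_le_geometric[OF P layer])
    show "measure P {\<omega> \<in> space P. layer (X \<omega>) = k} * F k powr s
        \<le> (1/2) ^ k * (K * B powr s * exp (- L))" for k
      using weight_mult_precision_powr_le[OF weight \<open>0 < s\<close> \<open>0 \<le> B\<close>, of k L] \<open>0 \<le> K\<close>
      by (simp add: F_def mult.assoc)
  qed (use \<open>0 \<le> K\<close> in simp)
  finally have "quant_err P X S d s r \<le> (2 * (K * B powr s * exp (- L))) powr (1 / s)"
    using C card \<open>0 < s\<close> \<open>0 \<le> K\<close> by (intro quant_err_le) (auto simp: C_def)
  also have "\<dots> = (2 * K) powr (1 / s) * B * exp (- (L / s))"
    using \<open>0 < s\<close> \<open>0 \<le> K\<close> \<open>0 \<le> B\<close> by (simp add: powr_mult powr_powr) (simp add: powr_def)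
  finally show ?thesis .
qed

section \<open>Poisson weights\<close>

definition poisson_exponent :: "real \<Rightarrow> nat \<Rightarrow> real" where
  "poisson_exponent b k = real k * (ln (real k) - b)"

lemma inverse_fact_le: "1 / fact k \<le> exp (- poisson_exponent 1 k)"
proof (cases "k = 0")
  case False
  have "real k ^ k / fact k * exp (- real k) \<le> 1"
    using pmf_le_1[of "poisson_pmf (real k)" k] False by simp
  moreover have "exp (real k * ln (real k)) = real k ^ k" using False by (simp add: exp_of_nat_mult)
  ultimately show ?thesis
    using False
    by (simp add: poisson_exponent_def right_diff_distrib exp_diff exp_minus field_simps)
qed (simp add: poisson_exponent_def)

lemma poisson_density_le:
  assumes "lam > 0" and b: "ln (2 * lam) + 1 \<le> b"
  shows "lam ^ k / fact k * exp (- lam) \<le> (1/2) ^ k * exp (- poisson_exponent b k)"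
proof -
  have "lam ^ k / fact k * exp (- lam) \<le> lam ^ k / fact k"
    using \<open>lam > 0\<close> by (intro mult_left_le) auto
  also have "\<dots> = (1/2) ^ k * (2 * lam) ^ k * (1 / fact k)"
    by (simp add: power_mult_distrib power_divide)
  also have "\<dots> \<le> (1/2) ^ k * (2 * lam) ^ k * exp (- poisson_exponent 1 k)"
    using \<open>lam > 0\<close> by (intro mult_left_mono inverse_fact_le) auto
  also have "\<dots> = (1/2) ^ k * (exp (real k * ln (2 * lam)) * exp (- poisson_exponent 1 k))"
    using \<open>lam > 0\<close> by (simp add: exp_of_nat_mult)
  also have "\<dots> = (1/2) ^ k * exp (- poisson_exponent (ln (2 * lam) + 1) k)"
    unfolding exp_add[symmetric] by (simp add: poisson_exponent_def algebra_simps)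
  also have "\<dots> \<le> (1/2) ^ k * exp (- poisson_exponent b k)"
    using b by (auto simp: poisson_exponent_def intro!: mult_left_mono)
  finally show ?thesis .
qed

lemma poisson_exponent_ge: "- (real k * b) \<le> poisson_exponent b k"
proof -
  have "0 \<le> real k * ln (real k)" by (cases k) auto
  then show ?thesis by (simp add: poisson_exponent_def right_diff_distrib)
qed

lemma eventually_poisson_exponent_ge:
  "eventually (\<lambda>L. \<forall>k. 2 * L / ln L \<le> real k \<longrightarrow> L \<le> poisson_exponent b k) at_top"
proof -
  have "eventually (\<lambda>L. L \<le> 2 * L / ln L * (ln (2 * L / ln L) - b)) at_top"
    and "eventually (\<lambda>L. b \<le> ln (2 * L / ln L)) at_top"
    by real_asymp+
  then show ?thesis using eventually_gt_at_top[of 1]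
  proof eventually_elim
    case (elim L)
    define x where "x = 2 * L / ln L"
    have "x > 0" using elim by (simp add: x_def)
    have "L \<le> poisson_exponent b k" if "x \<le> real k" for k
    proof -
      have "ln x \<le> ln (real k)" using \<open>x > 0\<close> that by (intro ln_mono) auto
      then have "x * (ln x - b) \<le> poisson_exponent b k"
        unfolding poisson_exponent_def using that \<open>x > 0\<close> elim(2)
        by (intro mult_mono) (auto simp: x_def)
      with elim(1) show ?thesis by (simp add: x_def)
    qed
    then show ?case by (simp add: x_def)
  qed
qed

lemma mult_diff_le_parabola_max:
  fixes a x L :: real
  assumes "a > 0"
  shows "x * (L - a * x) \<le> L\<^sup>2 / (4 * a)"
proof -
  have "0 \<le> (L - 2 * a * x)\<^sup>2" by simp
  then show ?thesis using assms by (simp add: field_simps power2_eq_square)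
qed

text \<open>For \<open>k > L powr \<beta>\<close> with \<open>\<beta>\<close> close to 1, \<open>ln k\<close> is almost \<open>ln L\<close>, which bounds the left-hand
  side by a parabola in \<open>k\<close>; smaller \<open>k\<close> are negligible.\<close>

lemma eventually_mult_exponent_deficit_le:
  assumes "c > 1" "b \<ge> 0"
  shows "eventually (\<lambda>L. \<forall>k. real k * max 0 (L - poisson_exponent b k) \<le> c * (L\<^sup>2 / (4 * ln L)))
    at_top"
proof -
  obtain \<beta> where \<beta>: "1 / c < \<beta>" "\<beta> < 1" using dense[of "1 / c" 1] \<open>c > 1\<close> by auto
  then have "\<beta> > 0" using \<open>c > 1\<close> by (meson divide_pos_pos less_trans zero_less_one)
  have "eventually (\<lambda>L. L powr \<beta> * (L + L powr \<beta> * b) \<le> c * (L\<^sup>2 / (4 * ln L))) at_top"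
    using \<beta> \<open>\<beta> > 0\<close> assms by (cases "b = 0") (simp, real_asymp)+
  moreover have "eventually (\<lambda>L. (1 / c) * ln L \<le> \<beta> * ln L - b) at_top"
    using \<beta> by real_asymp
  ultimately show ?thesis using eventually_gt_at_top[of 1]
  proof eventually_elim
    case (elim L)
    have ln_L: "ln L > 0" and bound_nonneg: "0 \<le> c * (L\<^sup>2 / (4 * ln L))"
      using elim assms by simp_all
    have "real k * max 0 (L - poisson_exponent b k) \<le> c * (L\<^sup>2 / (4 * ln L))" for k
    proof (cases "real k \<le> L powr \<beta>")
      case True
      have "L - poisson_exponent b k \<le> L + real k * b" using poisson_exponent_ge[of k b] by simp
      also have "\<dots> \<le> L + L powr \<beta> * b" using True assms by (simp add: mult_right_mono)
      finally have "max 0 (L - poisson_exponent b k) \<le> L + L powr \<beta> * b" using elim assms by simp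
      then have "real k * max 0 (L - poisson_exponent b k) \<le> L powr \<beta> * (L + L powr \<beta> * b)"
        using True by (intro mult_mono) auto
      with elim(1) show ?thesis by linarith
    next
      case False
      then have "ln (L powr \<beta>) \<le> ln (real k)" using elim by (intro ln_mono) auto
      then have "(1 / c) * ln L \<le> ln (real k) - b" using elim by (simp add: ln_powr)
      then have "real k * ((1 / c) * ln L) \<le> poisson_exponent b k"
        unfolding poisson_exponent_def by (intro mult_left_mono) auto
      then have "real k * (L - poisson_exponent b k) \<le> real k * (L - (1 / c) * ln L * real k)"
        by (intro mult_left_mono) (auto simp: mult.commute)
      also have "\<dots> \<le> L\<^sup>2 / (4 * ((1 / c) * ln L))"
        using assms ln_L by (intro mult_diff_le_parabola_max) auto
      also have "\<dots> = c * (L\<^sup>2 / (4 * ln L))" by simp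
      finally show ?thesis using bound_nonneg by (simp add: max_def)
    qed
    then show ?case by blast
  qed
qed

lemma eventually_code_length_le:
  assumes "0 < \<alpha>" "\<alpha> < a * s" "0 < s" "0 \<le> b" "0 \<le> h"
  shows "eventually (\<lambda>L. \<forall>k. real k \<le> 2 * L / ln L \<longrightarrow>
    code_length \<alpha> k (h + max 0 (L - poisson_exponent b k) / s) + ln (2 * L / ln L + 1)
      \<le> a * (L\<^sup>2 / (4 * ln L))) at_top"
proof -
  obtain c where c: "1 < c" "c < a * s / \<alpha>" using dense[of 1 "a * s / \<alpha>"] assms by auto
  define gap where "gap = a - \<alpha> / s * c"
  have "gap > 0" using c(2) assms by (simp add: gap_def field_simps)
  have "eventually (\<lambda>L. ln (2 * L / ln L + 1)
      + (2 * L / ln L + 1) * (\<alpha> * h + ln (2 * (2 * L / ln L + 1)))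
      + \<alpha> / s * (L + 2 * L / ln L * b) \<le> gap * (L\<^sup>2 / (4 * ln L))) at_top"
    using \<open>gap > 0\<close> by real_asymp
  then show ?thesis
    using eventually_mult_exponent_deficit_le[OF c(1) \<open>0 \<le> b\<close>] eventually_gt_at_top[of 1]
  proof eventually_elim
    case (elim L)
    define x where "x = 2 * L / ln L"
    define bound where "bound = L\<^sup>2 / (4 * ln L)"
    show ?case
    proof (intro allI impI)
      fix k assume k: "real k \<le> 2 * L / ln L"
      define M where "M = max 0 (L - poisson_exponent b k)"
      have "real k * b \<le> x * b" unfolding x_def using k \<open>0 \<le> b\<close> by (rule mult_right_mono)
      moreover have "0 \<le> real k * b" using \<open>0 \<le> b\<close> by simp
      ultimately have "M \<le> L + x * b"
        using elim(3) poisson_exponent_ge[of k b] unfolding M_def by linarith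
      moreover have "real k * M \<le> c * bound" using elim(2) by (simp add: M_def bound_def)
      ultimately have "real (k + 1) * M \<le> c * bound + (L + x * b)" by (simp add: distrib_right)
      then have "\<alpha> / s * (real (k + 1) * M) \<le> \<alpha> / s * (c * bound + (L + x * b))"
        using assms by (intro mult_left_mono) auto
      moreover have "code_length \<alpha> k h \<le> (x + 1) * (\<alpha> * h + ln (2 * (x + 1)))"
        unfolding code_length_def using k assms by (intro mult_mono add_mono) (auto simp: x_def)
      moreover have "code_length \<alpha> k (h + M / s) = \<alpha> / s * (real (k + 1) * M) + code_length \<alpha> k h"
        by (simp add: code_length_def algebra_simps add_divide_distrib)
      moreover have "\<alpha> / s * (c * bound + (L + x * b)) + gap * bound
          = a * bound + \<alpha> / s * (L + x * b)"
        by (simp add: gap_def algebra_simps)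
      ultimately show "code_length \<alpha> k (h + max 0 (L - poisson_exponent b k) / s)
          + ln (2 * L / ln L + 1) \<le> a * (L\<^sup>2 / (4 * ln L))"
        using elim(1) unfolding x_def[symmetric] M_def[symmetric] bound_def[symmetric] by linarith
    qed
  qed
qed

section \<open>Quantization of paths with Poisson-like numbers of jumps\<close>

lemma card_UN_le_exp:
  assumes "\<And>k. k \<le> n \<Longrightarrow> real (card (G k)) \<le> exp (r - ln (real n + 1))"
  shows "real (card (\<Union>k\<le>n. G k)) \<le> exp r"
proof -
  have "card (\<Union>k\<le>n. G k) \<le> (\<Sum>k\<le>n. card (G k))" by (rule card_UN_le) simp
  then have "real (card (\<Union>k\<le>n. G k)) \<le> (\<Sum>k\<le>n. real (card (G k)))"
    by (metis of_nat_le_iff of_nat_sum)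
  also have "\<dots> \<le> (\<Sum>k\<le>n. exp (r - ln (real n + 1)))" using assms by (intro sum_mono) auto
  also have "\<dots> = exp r" by (simp add: exp_diff add.commute)
  finally show ?thesis .
qed

lemma quant_err_le_of_path_nets:
  fixes \<phi> :: "nat \<Rightarrow> real"
  assumes "0 < s" "0 \<le> K" "0 \<le> w"
    and \<rho>: "distortion_measure ME \<rho>"
    and w: "\<And>x y. x \<in> space ME \<Longrightarrow> y \<in> space ME \<Longrightarrow> \<rho> x y \<le> w"
    and P: "prob_space P" and X: "X \<in> measurable P (Dspace ME)"
    and weight: "\<And>k. measure P {\<omega> \<in> space P. num_jumps (X \<omega>) = k} \<le> (1/2) ^ k * K * exp (- \<phi> k)"
    and nets: "\<And>k y. 0 \<le> y \<Longrightarrow> \<exists>G. path_net (space ME) \<rho> k ((1 + w) * exp (- y)) G \<and>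
      real (card G) \<le> exp (len k y)"
    and len: "\<And>k. k \<le> n \<Longrightarrow> len k (max 0 (L - \<phi> k) / s) + ln (real n + 1) \<le> r"
    and tail: "\<And>k. n < k \<Longrightarrow> L \<le> \<phi> k"
  shows "quant_err P X (Dset (space ME)) (rhoD \<rho>) s r
    \<le> (2 * K) powr (1 / s) * (1 + w) * exp (- (L / s))"
proof -
  let ?E = "space ME"
  have \<rho>_nonneg: "0 \<le> \<rho> x y" if "x \<in> ?E" "y \<in> ?E" for x y
    using \<rho> that by (simp add: distortion_measure_def)
  define y where "y k = max 0 (L - \<phi> k) / s" for k
  have "0 \<le> y k" for k using \<open>0 < s\<close> by (simp add: y_def)
  then have "\<forall>k. \<exists>G. path_net ?E \<rho> k ((1 + w) * exp (- y k)) G \<and> real (card G) \<le> exp (len k (y k))"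
    using nets by blast
  from choice[OF this] obtain G where G: "\<And>k. path_net ?E \<rho> k ((1 + w) * exp (- y k)) (G k)"
    "\<And>k. real (card (G k)) \<le> exp (len k (y k))"
    by blast
  have "?E \<noteq> {}" using Dset_nonempty_if_measurable_Dspace[OF P X] Dset_empty by metis
  then obtain f where "f \<in> Dset ?E" "num_jumps f = 0" by (rule Dset_obtain_no_jumps)
  then have "G 0 \<noteq> {}" using finite_netD(3)[OF G(1)[of 0], of f] by auto
  then have nonempty: "(\<Union>k\<le>n. G k) \<noteq> {}" by auto
  have "real (card (G k)) \<le> exp (r - ln (real n + 1))" if "k \<le> n" for k
    using len[OF that] by (intro order_trans[OF G(2)]) (simp add: y_def)
  then have card: "real (card (\<Union>k\<le>n. G k)) \<le> exp r" by (rule card_UN_le_exp)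
  show ?thesis
  proof (rule quant_err_le_of_layer_nets[OF P _ _ _ \<open>0 < s\<close> _ \<open>0 \<le> K\<close> weight _ tail nonempty card])
    show "X \<omega> \<in> Dset ?E" if "\<omega> \<in> space P" for \<omega>
      using measurable_space[OF X that] by (simp add: space_Dspace)
    show "(\<lambda>\<omega>. num_jumps (X \<omega>)) \<in> measurable P (count_space UNIV)"
      using X measurable_num_jumps[OF \<rho>] by (rule measurable_compose)
    show "0 \<le> rhoD \<rho> f g \<and> rhoD \<rho> f g \<le> 1 + w" if "f \<in> Dset ?E" "g \<in> Dset ?E" for f g
    proof -
      have "0 \<le> rhoD \<rho> f g" using \<rho>_nonneg that by (rule rhoD_nonneg)
      moreover have "rhoD \<rho> f g \<le> w" using that \<open>0 \<le> w\<close> w by (rule rhoD_le_bound)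
      ultimately show ?thesis by simp
    qed
    show "path_net ?E \<rho> k ((1 + w) * exp (- (max 0 (L - \<phi> k) / s))) (G k)" for k
      using G(1)[of k] by (simp add: y_def)
  qed (use \<open>0 \<le> w\<close> in simp)
qed

lemma eventually_quant_err_le:
  assumes "0 < s" "0 \<le> K" "0 \<le> b" "0 \<le> w"
    and \<rho>: "distortion_measure ME \<rho>"
    and w: "\<And>x y. x \<in> space ME \<Longrightarrow> y \<in> space ME \<Longrightarrow> \<rho> x y \<le> w"
    and dim: "upper_box_dim (space ME) \<rho> = ereal \<gamma>" and a: "(1 + \<gamma>) / s < a"
    and P: "prob_space P" and X: "X \<in> measurable P (Dspace ME)"
    and weight: "\<And>k. measure P {\<omega> \<in> space P. num_jumps (X \<omega>) = k}
      \<le> (1/2) ^ k * K * exp (- poisson_exponent b k)"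
  shows "eventually (\<lambda>L. \<forall>r\<ge>a * (L\<^sup>2 / (4 * ln L)).
    quant_err P X (Dset (space ME)) (rhoD \<rho>) s r
      \<le> (2 * K) powr (1 / s) * (1 + w) * exp (- (L / s))) at_top"
proof -
  have "\<gamma> < a * s - 1" using a \<open>0 < s\<close> by (simp add: field_simps)
  then obtain \<gamma>' where \<gamma>': "\<gamma> < \<gamma>'" "\<gamma>' < a * s - 1" using dense by blast
  then have dim': "upper_box_dim (space ME) \<rho> < ereal \<gamma>'" using dim by simp
  have E: "space ME \<noteq> {}" using Dset_nonempty_if_measurable_Dspace[OF P X] Dset_empty by metis
  obtain h where "0 \<le> h" and nets: "\<And>k y. 0 \<le> y \<Longrightarrow> \<exists>G.
      path_net (space ME) \<rho> k ((1 + w) * exp (- y)) G \<and>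
      real (card G) \<le> exp (code_length (1 + \<gamma>') k (h + y))"
    using obtain_path_nets[OF dim' E \<open>0 \<le> w\<close> w] by blast
  have "0 \<le> \<gamma>" using upper_box_dim_nonneg[of "space ME" \<rho>] dim by simp
  with \<gamma>' have "0 < 1 + \<gamma>'" "1 + \<gamma>' < a * s" by auto
  from eventually_code_length_le[OF this \<open>0 < s\<close> \<open>0 \<le> b\<close> \<open>0 \<le> h\<close>]
    eventually_poisson_exponent_ge[of b] eventually_gt_at_top[of 1]
  show ?thesis
  proof eventually_elim
    case (elim L)
    define x where "x = 2 * L / ln L"
    define n where "n = nat \<lfloor>x\<rfloor>"
    have "x > 0" using elim by (simp add: x_def)
    then have le_n_iff: "k \<le> n \<longleftrightarrow> real k \<le> x" for k unfolding n_def by linarith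
    show ?case
    proof (intro allI impI, rule quant_err_le_of_path_nets[OF assms(1,2,4) \<rho> w P X weight nets])
      fix r k assume r: "a * (L\<^sup>2 / (4 * ln L)) \<le> r" and "k \<le> n"
      then have "code_length (1 + \<gamma>') k (h + max 0 (L - poisson_exponent b k) / s) + ln (x + 1)
          \<le> a * (L\<^sup>2 / (4 * ln L))"
        using elim(1) unfolding le_n_iff x_def by blast
      moreover have "ln (real n + 1) \<le> ln (x + 1)" using le_n_iff[of n] by simp
      ultimately show "code_length (1 + \<gamma>') k (h + max 0 (L - poisson_exponent b k) / s)
          + ln (real n + 1) \<le> r"
        using r by linarith
    next
      show "L \<le> poisson_exponent b k" if "n < k" for k
        using elim(2) le_n_iff[of k] that by (simp add: x_def)
    qed
  qed
qed

lemma neg_log_ge: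
  assumes "0 \<le> x" "x \<le> A * exp (- y)" "0 < A"
  shows "ereal (y - ln A) \<le> neg_log x"
proof (cases "x = 0")
  case False
  then have "ln x \<le> ln (A * exp (- y))" using assms by (intro ln_mono) auto
  also have "\<dots> = ln A - y" using \<open>0 < A\<close> by (simp add: ln_mult)
  finally show ?thesis using False by (simp add: neg_log_def)
qed (simp add: neg_log_def)

lemma tendsto_square_over_ln_sqrt:
  fixes c \<sigma> :: real
  assumes "0 < c" "0 < \<sigma>"
  defines "L \<equiv> \<lambda>r. \<sigma> * sqrt (c * r * ln r)"
  shows "((\<lambda>r. (L r)\<^sup>2 / (4 * ln (L r)) / r) \<longlongrightarrow> \<sigma>\<^sup>2 * c / 2) at_top"
proof -
  have "((\<lambda>r. (L r)\<^sup>2 / (4 * ln (L r)) / r) \<longlongrightarrow> (\<sigma> * c powr (1 / 2))\<^sup>2 / 2) at_top"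
    unfolding L_def using assms(1,2) by real_asymp
  also have "(\<sigma> * c powr (1 / 2))\<^sup>2 = \<sigma>\<^sup>2 * c"
    using \<open>0 < c\<close> by (simp add: powr_half_sqrt power_mult_distrib)
  finally show ?thesis .
qed

text \<open>Inverts the rate \<open>r = \<kappa> / s * (L\<^sup>2 / (4 * ln L))\<close> asymptotically: for \<open>\<theta>\<close> slightly below 1,
  \<open>L = s * \<theta> * sqrt (2 / (s * \<kappa>) * r * ln r)\<close> is admissible with \<open>\<kappa> / \<theta>\<close> in place of \<open>\<kappa>\<close>.\<close>

lemma eventually_neg_log_ge:
  fixes D :: "real \<Rightarrow> real"
  assumes "0 < s" "0 < \<kappa>" "0 < \<eta>" "\<eta> < 1" and nonneg: "\<And>r. 0 \<le> r \<Longrightarrow> 0 \<le> D r"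
    and decay: "\<And>a. \<kappa> / s < a \<Longrightarrow>
      \<exists>A>0. eventually (\<lambda>L. \<forall>r\<ge>a * (L\<^sup>2 / (4 * ln L)). D r \<le> A * exp (- (L / s))) at_top"
  shows "eventually (\<lambda>r. ereal (\<eta> * sqrt (2 / (s * \<kappa>) * r * ln r)) \<le> neg_log (D r)) at_top"
proof -
  obtain \<theta> where \<theta>: "\<eta> < \<theta>" "\<theta> < 1" using dense[OF \<open>\<eta> < 1\<close>] by blast
  then have "0 < \<theta>" using \<open>0 < \<eta>\<close> by simp
  define c where "c = 2 / (s * \<kappa>)"
  have "0 < c" using assms(1,2) by (simp add: c_def)
  define S where "S r = sqrt (c * r * ln r)" for r
  define L where "L r = s * \<theta> * S r" for r
  have "\<kappa> / s < \<kappa> / (s * \<theta>)"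
    using \<theta> \<open>0 < \<theta>\<close> assms(1,2) by (intro divide_strict_left_mono) auto
  then obtain A where "0 < A" and A:
    "eventually (\<lambda>L. \<forall>r\<ge>\<kappa> / (s * \<theta>) * (L\<^sup>2 / (4 * ln L)). D r \<le> A * exp (- (L / s))) at_top"
    using decay by blast
  have "filterlim L at_top at_top"
    unfolding L_def[abs_def] S_def using \<open>0 < s\<close> \<open>0 < \<theta>\<close> \<open>0 < c\<close> by real_asymp
  with A have bound: "eventually (\<lambda>r. \<forall>r'\<ge>\<kappa> / (s * \<theta>) * ((L r)\<^sup>2 / (4 * ln (L r))).
      D r' \<le> A * exp (- (L r / s))) at_top"
    by (rule eventually_compose_filterlim)
  have "((\<lambda>r. \<kappa> / (s * \<theta>) * ((L r)\<^sup>2 / (4 * ln (L r)) / r))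
      \<longlongrightarrow> \<kappa> / (s * \<theta>) * ((s * \<theta>)\<^sup>2 * c / 2)) at_top"
    unfolding L_def S_def using \<open>0 < s\<close> \<open>0 < \<theta>\<close> \<open>0 < c\<close>
    by (intro tendsto_mult_left tendsto_square_over_ln_sqrt) auto
  also have "\<kappa> / (s * \<theta>) * ((s * \<theta>)\<^sup>2 * c / 2) = \<theta>"
    using \<open>0 < \<theta>\<close> assms(1,2) by (simp add: c_def power2_eq_square)
  finally have rate: "eventually (\<lambda>r. \<kappa> / (s * \<theta>) * ((L r)\<^sup>2 / (4 * ln (L r)) / r) < 1) at_top"
    using \<theta>(2) by (rule order_tendstoD(2))
  have const: "eventually (\<lambda>r. ln A \<le> (\<theta> - \<eta>) * S r) at_top"
    unfolding S_def using \<theta> \<open>0 < c\<close> by real_asymp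
  show ?thesis
    using bound rate const eventually_gt_at_top[of 1]
  proof eventually_elim
    case (elim r)
    have "\<kappa> / (s * \<theta>) * ((L r)\<^sup>2 / (4 * ln (L r))) \<le> r"
      using elim(2,4) unfolding times_divide_eq_right by (subst (asm) divide_less_eq_1_pos) auto
    then have "D r \<le> A * exp (- (\<theta> * S r))" using elim(1) \<open>0 < s\<close> by (simp add: L_def)
    then have "ereal (\<theta> * S r - ln A) \<le> neg_log (D r)"
      using nonneg[of r] elim(4) \<open>0 < A\<close> by (intro neg_log_ge) auto
    moreover have "\<eta> * S r \<le> \<theta> * S r - ln A" using elim(3) by (simp add: left_diff_distrib)
    ultimately have "ereal (\<eta> * S r) \<le> neg_log (D r)" by (meson ereal_less_eq(3) order_trans)
    then show ?case by (simp only: S_def c_def)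
  qed
qed

lemma one_le_Liminf_divide_ereal:
  fixes f :: "'a \<Rightarrow> ereal" and S :: "'a \<Rightarrow> real"
  assumes S: "eventually (\<lambda>x. 0 < S x) F"
    and f: "\<And>\<eta>. 0 < \<eta> \<Longrightarrow> \<eta> < 1 \<Longrightarrow> eventually (\<lambda>x. ereal (\<eta> * S x) \<le> f x) F"
  shows "1 \<le> Liminf F (\<lambda>x. f x / ereal (S x))"
  unfolding le_Liminf_iff
proof (intro allI impI)
  fix z :: ereal assume "z < 1"
  then obtain \<eta> where "max 0 z < ereal \<eta>" "ereal \<eta> < 1" using ereal_dense2[of "max 0 z" 1] by auto
  then have \<eta>: "z < ereal \<eta>" "0 < \<eta>" "\<eta> < 1" by (auto simp: one_ereal_def)
  show "eventually (\<lambda>x. z < f x / ereal (S x)) F"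
    using S f[OF \<eta>(2,3)]
  proof eventually_elim
    case (elim x)
    then have "ereal \<eta> \<le> f x / ereal (S x)" by (subst ereal_le_divide_pos) (auto simp: mult.commute)
    with \<eta>(1) show ?case by (rule less_le_trans)
  qed
qed

theorem theorem1:
  fixes ME :: "'e measure" and \<rho> :: "'e \<Rightarrow> 'e \<Rightarrow> real"
    and P :: "'w measure" and X :: "'w \<Rightarrow> real \<Rightarrow> 'e"
    and s lam K \<gamma> :: real
  assumes "s > 0" and "lam > 0" and "K \<ge> 1"
    and "distortion_measure ME \<rho>"
    and "\<exists>w. \<forall>x\<in>space ME. \<forall>y\<in>space ME. \<rho> x y \<le> w"
    and "upper_box_dim (space ME) \<rho> = ereal \<gamma>"
    and "prob_space P"
    and "X \<in> measurable P (Dspace ME)"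
    and "\<And>k::nat. measure P {\<omega> \<in> space P. num_jumps (X \<omega>) = k}
                    \<le> lam ^ k / fact k * exp (- lam) * K"
  shows "Liminf at_top (\<lambda>r. neg_log (quant_err P X (Dset (space ME)) (rhoD \<rho>) s r)
            / ereal (sqrt (2 / (s * (1 + \<gamma>)) * r * ln r))) \<ge> 1"
proof -
  define D where "D = quant_err P X (Dset (space ME)) (rhoD \<rho>) s"
  define b where "b = max 0 (ln (2 * lam) + 1)"
  have "0 \<le> \<gamma>" using upper_box_dim_nonneg[of "space ME" \<rho>] assms(6) by simp
  obtain w where w: "0 \<le> w" "\<And>x y. x \<in> space ME \<Longrightarrow> y \<in> space ME \<Longrightarrow> \<rho> x y \<le> w"
    using assms(5) by (metis max.cobounded1 max.coboundedI2)
  have weight: "measure P {\<omega> \<in> space P. num_jumps (X \<omega>) = k}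
      \<le> (1/2) ^ k * K * exp (- poisson_exponent b k)" for k
    using order_trans[OF assms(9) mult_right_mono[OF poisson_density_le[of lam b k], of K]] assms(2,3)
    by (simp add: b_def mult_ac)
  have "\<exists>A>0. eventually (\<lambda>L. \<forall>r\<ge>a * (L\<^sup>2 / (4 * ln L)). D r \<le> A * exp (- (L / s))) at_top"
    if "(1 + \<gamma>) / s < a" for a
    unfolding D_def using assms(1,3) w(1)
    by (intro exI[of _ "(2 * K) powr (1 / s) * (1 + w)"] conjI
        eventually_quant_err_le[OF _ _ _ w(1) assms(4) w(2) assms(6) that assms(7,8) weight])
      (auto simp: b_def)
  moreover have "0 \<le> D r" if "0 \<le> r" for r
    unfolding D_def by (rule quant_err_nonneg[OF Dset_nonempty_if_measurable_Dspace[OF assms(7,8)] that])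
  ultimately have "eventually (\<lambda>r. ereal (\<eta> * sqrt (2 / (s * (1 + \<gamma>)) * r * ln r))
      \<le> neg_log (D r)) at_top" if "0 < \<eta>" "\<eta> < 1" for \<eta>
    using that assms(1) \<open>0 \<le> \<gamma>\<close> by (intro eventually_neg_log_ge) auto
  moreover have "eventually (\<lambda>r. 0 < sqrt (2 / (s * (1 + \<gamma>)) * r * ln r)) at_top"
    using assms(1) \<open>0 \<le> \<gamma>\<close> by (intro eventually_mono[OF eventually_gt_at_top[of 1]]) simp
  ultimately show ?thesis unfolding D_def[symmetric] by (intro one_le_Liminf_divide_ereal)
qed

end
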